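(* Let $\lambda\in\{-1,0\}$, let $p\ge 0$ be an integer, $n\in\{1,2,\dots\}$, and let $\alpha=\alpha(n)\ge 0$ with $\alpha(n)\to0$ as $n\to\infty$. Then for $x\in I$: $$L_n^{(\alpha)}(1;x)=1,\qquad L_n^{(\alpha)}(t;x)=\frac{n+p}{n}\cdot\frac{x}{1-(\lambda+1)\alpha},$$ $$L_n^{(\alpha)}(t^2;x)=\frac{n+p}{n^2}\cdot\frac{1}{(1-\lambda\alpha)(1-(\lambda+1)\alpha)}\left[\frac{(n+p+\lambda+1)x(x+\alpha)}{1-2(\lambda+1)\alpha}+x(1+\lambda x)\right],$$ $$L_n^{(\alpha)}(t^3;x)=\frac{(n+p)x}{n^3(1-(\lambda+1)\alpha)}\left[\frac{(n+p+2\lambda+1)(n+p+2(2\lambda+1))(x+\alpha)(x+2\alpha)}{(1-(3\lambda+2)\alpha)(1-(5\lambda+3)\alpha)}+\frac{3(n+p+2\lambda+1)(x+\alpha)}{1-(3\lambda+2)\alpha}+1\right],$$ and $$\begin{aligned}L_n^{(\alpha)}(t^4;x)=\frac{(n+p)x}{n^4(1-(\lambda+1)\alpha)}\Bigg[&\frac{(n+p+2\lambda+1)(n+p+2(2\lambda+1))(n+p+3(2\lambda+1))(x+\alpha)(x+2\alpha)(x+3\alpha)}{(1-(3\lambda+2)\alpha)(1-(5\lambda+3)\alpha)(1-(7\lambda+4)\alpha)}\\&+\frac{6(n+p+2\lambda+1)(n+p+2(2\lambda+1))(x+\alpha)(x+2\alpha)}{(1-(3\lambda+2)\alpha)(1-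(5\lambda+3)\alpha)}+\frac{7(n+p+2\lambda+1)(x+\alpha)}{1-(3\lambda+2)\alpha}+1\Bigg].\end{aligned}$$
   Context: Factorial powers: $y^{[m,h]}=y(y-h)(y-2h)\cdots(y-(m-1)h)$ and $y^{[0,h]}=1$; thus $y^{[m,-\alpha]}=\prod_{i=0}^{m-1}(y+i\alpha)$. Interval: $I=[0,1]$ if $\lambda=-1$ and $I=[0,\infty)$ if $\lambda=0$. Operators: for a real-valued function $f$ and $x\in I$, $$L_n^{(\alpha)}(f;x)=\sum_k w_{n,k}^{(\alpha)}(x)\,f\!\left(\tfrac kn\right),$$ $$w_{n,k}^{(\alpha)}(x)=\frac{n+p}{n+p+(\lambda+1)k}\binom{n+p+(\lambda+1)k}{k}\frac{x^{[k,-\alpha]}(1+\lambda x)^{[n+p+\lambda k,-\alpha]}}{(1+(\lambda+1)x)^{[n+p+(\lambda+1)k,-\alpha]}},$$ where the sum is over $0\le k\le n+p$ if $\lambda=-1$ and over all integers $k\ge 0$ if $\lambda=0$. $L_n^{(\alpha)}(g(t);x)$ means the operator applied to the function $t\mapsto g(t)$, evaluated at $x$.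
   Formalization: For λ=0 and x>0 the identity for t^r (r=1,…,4) is stated only for those n with rα(n)<1; otherwise the series L_n^{(α)}(t^r;x) diverges. Since α(n)→0, this excludes only finitely many n. *)

theory Defs
  imports Complex_Main
begin

definition factorial_power :: "real \<Rightarrow> nat \<Rightarrow> real \<Rightarrow> real" where
  "factorial_power y m h = (\<Prod>i<m. y - real i * h)"

definition I_interval :: "int \<Rightarrow> real set" where
  "I_interval l = (if l = -1 then {0..1} else {0..})"

(* l is the parameter lambda in {-1, 0}; a is alpha(n).
   The arguments of "nat" are nonnegative for l = 0, and for l = -1 as long as k \<le> n + p;
   weights outside that range are never used. *)
definition w :: "int \<Rightarrow> nat \<Rightarrow> real \<Rightarrow> nat \<Rightarrow> nat \<Rightarrow> real \<Rightarrow> real" where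
  "w l p a n k x =
     real (n + p) / (real (n + p) + (of_int l + 1) * real k)
     * real (nat (int (n + p) + (l + 1) * int k) choose k)
     * (factorial_power x k (- a)
        * factorial_power (1 + of_int l * x) (nat (int (n + p) + l * int k)) (- a)
        / factorial_power (1 + (of_int l + 1) * x) (nat (int (n + p) + (l + 1) * int k)) (- a))"

(* For l = 0 this is an infinite series; its value is meaningful only when the series
   converges, which is recorded separately by L_converges.
   For x > 0 the weights decay like k powr (-1 - 1/a) if a > 0, geometrically if a = 0, so the series for f t = t ^ r
   with r \<ge> 1 converges iff r * a < 1. *)
definition L :: "int \<Rightarrow> nat \<Rightarrow> real \<Rightarrow> nat \<Rightarrow> (real \<Rightarrow> real) \<Rightarrow> real \<Rightarrow> real" where
  "L l p a n f x =
     (if l = -1 then (\<Sum>k\<le>n + p. w l p a n k x * f (real k / real n))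
      else (\<Sum>k. w l p a n k x * f (real k / real n)))"

definition L_converges :: "int \<Rightarrow> nat \<Rightarrow> real \<Rightarrow> nat \<Rightarrow> (real \<Rightarrow> real) \<Rightarrow> real \<Rightarrow> bool" where
  "L_converges l p a n f x \<longleftrightarrow>
     l = -1 \<or> summable (\<lambda>k. w l p a n k x * f (real k / real n))"

end

theory Submission
  imports Defs "HOL-Analysis.Harmonic_Numbers"
begin

text \<open>
  For \<open>\<lambda> = -1\<close> the weights form a Polya distribution, whose total mass is the Vandermonde identity
  for rising powers. For \<open>\<lambda> = 0\<close> they form a negative Polya distribution with parameters
  \<open>M = n + p\<close>, \<open>x\<close> and \<open>y = 1\<close>; passing from \<open>M\<close> to \<open>M + 1\<close> lowers the
  partial sums by a gap term in closed form, and this gap tends to \<open>0\<close> because otherwise the convergent series for \<open>M + 1\<close> would dominate a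
  multiple of the harmonic series.
  In both cases multiplying the weights by \<open>k (k - 1) \<dots> (k - r + 1)\<close> yields, up to a constant factor, the
  weights of the same family with shifted parameters, which gives all factorial moments at once; the
  power moments follow with Stirling numbers of the second kind.
\<close>

section \<open>Algebra of factorial powers\<close>

abbreviation rising :: "real \<Rightarrow> real \<Rightarrow> nat \<Rightarrow> real" where
  "rising a y m \<equiv> factorial_power y m (- a)"

lemma factorial_power_0 [simp]: "factorial_power y 0 h = 1"
  by (simp add: factorial_power_def)

lemma factorial_power_Suc: "factorial_power y (Suc m) h = factorial_power y m h * (y - real m * h)"
  by (simp add: factorial_power_def)

lemma factorial_power_add:
  "factorial_power y (r + j) h = factorial_power y r h * factorial_power (y - real r * h) j h"
  by (induction j) (simp_all add: factorial_power_Suc algebra_simps)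

lemma factorial_power_Suc_left:
  "factorial_power y (Suc m) h = y * factorial_power (y - h) m h"
  using factorial_power_add[of y 1 m h] by (simp add: factorial_power_Suc)

text \<open>Both sides are the product of \<open>y - h\<close>, ..., \<open>y - r * h\<close>, read
  from opposite ends. This turns rising products at a lowered parameter into the falling
  denominators of the moments.\<close>

lemma factorial_power_reverse:
  "factorial_power (y - real r * h) r (- h) = factorial_power (y - h) r h"
proof (induction r)
  case (Suc r)
  have "factorial_power (y - real (Suc r) * h) (Suc r) (- h)
      = (y - real (Suc r) * h) * factorial_power (y - real r * h) r (- h)"
    using factorial_power_Suc_left[of "y - real (Suc r) * h" r "- h"] by (simp add: algebra_simps)
  also have "\<dots> = factorial_power (y - h) (Suc r) h"
    unfolding Suc.IH factorial_power_Suc by (simp add: algebra_simps)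
  finally show ?case .
qed simp

lemma rising_pos: "y > 0 \<Longrightarrow> a \<ge> 0 \<Longrightarrow> rising a y m > 0"
  unfolding factorial_power_def by (rule prod_pos) (simp add: add_pos_nonneg)

lemma rising_nonneg: "y \<ge> 0 \<Longrightarrow> a \<ge> 0 \<Longrightarrow> rising a y m \<ge> 0"
  unfolding factorial_power_def by (rule prod_nonneg) simp

lemma factorial_power_nat_fact: "factorial_power (real (j + r)) r 1 * fact j = fact (j + r)"
proof (induction r)
  case (Suc r)
  then show ?case
    using factorial_power_Suc_left[of "real (j + Suc r)" r 1] by simp
qed simp

lemma rising_nat_fact: "rising 1 (real (Suc M)) r * fact M = fact (M + r)"
proof (induction r)
  case (Suc r)
  have "rising 1 (real (Suc M)) (Suc r) * fact M
      = (rising 1 (real (Suc M)) r * fact M) * real (Suc (M + r))"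
    by (simp add: factorial_power_Suc)
  then show ?case
    unfolding Suc.IH by (simp add: mult.commute)
qed simp

lemma factorial_power_nat_eq_0: "M < r \<Longrightarrow> factorial_power (real M) r 1 = 0"
  unfolding factorial_power_def by (rule prod_zero) auto

section \<open>The negative Polya distribution and its total mass\<close>

text \<open>For \<open>a = 0\<close> this is the negative binomial distribution with success
  probability \<open>y / (x + y)\<close>. For \<open>M = 0\<close> the truncated
  \<open>M + k - 1\<close> makes it the point mass at \<open>0\<close>, which starts the induction
  on \<open>M\<close>.\<close>

definition nbinom_weight :: "real \<Rightarrow> real \<Rightarrow> real \<Rightarrow> nat \<Rightarrow> nat \<Rightarrow> real" where
  "nbinom_weight a x y M k =
     real ((M + k - 1) choose k) * rising a x k * rising a y M / rising a (x + y) (M + k)"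

text \<open>
  In the urn model this is the probability of exactly \<open>M\<close> successes before failure number \<open>K + 1\<close>.
\<close>

definition nbinom_gap :: "real \<Rightarrow> real \<Rightarrow> real \<Rightarrow> nat \<Rightarrow> nat \<Rightarrow> real" where
  "nbinom_gap a x y M K =
     real ((M + K) choose M) * rising a x (Suc K) * rising a y M / rising a (x + y) (Suc (M + K))"

lemma nbinom_weight_nonneg:
  "a \<ge> 0 \<Longrightarrow> x \<ge> 0 \<Longrightarrow> y > 0 \<Longrightarrow> nbinom_weight a x y M k \<ge> 0"
  by (simp add: nbinom_weight_def rising_nonneg)

lemma nbinom_gap_nonneg:
  "a \<ge> 0 \<Longrightarrow> x \<ge> 0 \<Longrightarrow> y > 0 \<Longrightarrow> nbinom_gap a x y M k \<ge> 0"
  by (simp add: nbinom_gap_def rising_nonneg)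

text \<open>In the urn model the difference is the probability that at most \<open>K\<close>
  failures precede success \<open>M\<close> but more than \<open>K\<close> precede success
  \<open>M + 1\<close>; this says that exactly \<open>M\<close> successes come before failure
  \<open>K + 1\<close>.\<close>

lemma sum_nbinom_weight_diff:
  assumes "a \<ge> 0" "x \<ge> 0" "y > 0"
  shows "(\<Sum>k<Suc K. nbinom_weight a x y M k) - (\<Sum>k<Suc K. nbinom_weight a x y (Suc M) k)
       = nbinom_gap a x y M K"
proof (induction K)
  case 0
  define s where "s = x + y + real M * a"
  have s: "s > 0"
    using assms unfolding s_def by (intro add_pos_nonneg add_nonneg_pos) auto
  have "rising a (x + y) M > 0"
    using assms by (simp add: rising_pos add_nonneg_pos)
  moreover have "rising a (x + y) (Suc M) = rising a (x + y) M * s"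
    by (simp add: factorial_power_Suc s_def)
  ultimately show ?case
    using s by (simp add: nbinom_weight_def nbinom_gap_def factorial_power_Suc divide_simps)
      (simp add: s_def algebra_simps)
next
  case (Suc K)
  \<comment> \<open>\<open>A\<close> is a common factor of all four terms in the step,
    \<open>s\<close> is the last factor of its denominator, and \<open>B\<close>, \<open>B'\<close>
    are the two Pascal parts of \<open>Suc (M + K) choose Suc K\<close>.\<close>
  define s where "s = x + y + real (M + K + 1) * a"
  define A where "A = rising a x (Suc K) * rising a y M / rising a (x + y) (Suc (Suc (M + K)))"
  define B where "B = real ((M + K) choose M)"
  define B' where "B' = real ((M + K) choose Suc K)"
  have s: "s > 0"
    using assms unfolding s_def by (intro add_pos_nonneg add_nonneg_pos) auto
  have R: "rising a (x + y) (Suc (M + K)) > 0"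
    using assms by (auto intro!: rising_pos add_nonneg_pos)
  have rs: "rising a (x + y) (Suc (Suc (M + K))) = rising a (x + y) (Suc (M + K)) * s"
    by (subst factorial_power_Suc) (simp add: s_def algebra_simps)
  have BK: "B = real ((M + K) choose K)"
    unfolding B_def by (subst binomial_symmetric) auto
  have BB: "real (Suc (M + K) choose Suc K) = B + B'"
    by (simp add: BK B'_def)
  have BB2: "real (Suc (M + K) choose M) = B + B'"
    by (subst binomial_symmetric) (simp_all add: BB Suc_diff_le del: binomial_Suc_Suc)
  have quot: "rising a x (Suc K) * (rising a y M / rising a (x + y) (Suc (M + K))) = s * A"
    using s R unfolding A_def rs by (simp add: field_simps)
  have 1: "nbinom_gap a x y M (Suc K) = (B + B') * (x + real (Suc K) * a) * A"
    unfolding nbinom_gap_def A_def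
    using factorial_power_Suc[of x "Suc K" "-a"] BB2 by simp
  have 2: "nbinom_gap a x y M K = B * s * A"
    unfolding nbinom_gap_def
    by (simp add: B_def quot mult.assoc flip: times_divide_eq_right)
  have 3: "nbinom_weight a x y M (Suc K) = B' * s * A"
    unfolding nbinom_weight_def
    by (simp add: B'_def quot mult.assoc flip: times_divide_eq_right)
  have 4: "nbinom_weight a x y (Suc M) (Suc K) = (B + B') * (y + real M * a) * A"
    unfolding nbinom_weight_def A_def using factorial_power_Suc[of y M "-a"] BB by simp
  \<comment> \<open>Up to the factor \<open>(B + B') * A\<close> this is the splitting of
    \<open>s\<close> into \<open>x + real (Suc K) * a\<close> and
    \<open>y + real M * a\<close>.\<close>
  have "nbinom_gap a x y M (Suc K) - nbinom_gap a x y M K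
      = nbinom_weight a x y M (Suc K) - nbinom_weight a x y (Suc M) (Suc K)"
    unfolding 1 2 3 4 s_def by (simp add: algebra_simps)
  then show ?case using Suc.IH by simp
qed

text \<open>The gap and the weight differ by a ratio of binomials, at most one by Pascal, and by
  single factors of the rising products, of which only \<open>s\<close> depends on \<open>K\<close>,
  and it grows at most linearly.\<close>

lemma nbinom_gap_le:
  assumes "a \<ge> 0" "x \<ge> 0" "y > 0"
  shows "nbinom_gap a x y M K
    \<le> (x + y + real M * a + a) / y * real (Suc K) * nbinom_weight a x y (Suc M) (Suc K)"
proof -
  define s where "s = x + y + real (M + K + 1) * a"
  define A where "A = rising a x (Suc K) * rising a y M / rising a (x + y) (Suc (Suc (M + K)))"
  have s: "s > 0"
    using assms unfolding s_def by (intro add_pos_nonneg add_nonneg_pos) auto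
  have R: "rising a (x + y) (Suc (M + K)) > 0"
    using assms by (auto intro!: rising_pos add_nonneg_pos)
  have rs: "rising a (x + y) (Suc (Suc (M + K))) = rising a (x + y) (Suc (M + K)) * s"
    by (subst factorial_power_Suc) (simp add: s_def algebra_simps)
  have A: "A \<ge> 0" unfolding A_def using assms by (simp add: rising_nonneg)
  have s_le: "s \<le> (x + y + real M * a + a) * real (Suc K)"
    using assms by (simp add: s_def algebra_simps)
  have "nbinom_gap a x y M K = real ((M + K) choose M) * (s * A)"
    using s R unfolding A_def rs nbinom_gap_def by (simp add: field_simps)
  also have "\<dots> \<le> real (Suc (M + K) choose Suc K) * (s * A)"
  proof (rule mult_right_mono)
    have "(M + K) choose M = (M + K) choose K"
      by (subst binomial_symmetric) auto
    then show "real ((M + K) choose M) \<le> real (Suc (M + K) choose Suc K)" by simp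
  qed (use s A in simp)
  also have "s * A \<le> (x + y + real M * a + a) * real (Suc K) * A"
    by (rule mult_right_mono[OF s_le A])
  \<comment> \<open>The factor \<open>(y + real M * a) / y\<close> is at least one; it supplies the
    last factor of \<open>rising a y (Suc M)\<close>.\<close>
  also have "\<dots> \<le> (x + y + real M * a + a) * real (Suc K) * (A * ((y + real M * a) / y))"
    using assms A by (intro mult_left_mono) (simp_all add: divide_simps algebra_simps)
  finally have "nbinom_gap a x y M K \<le> real (Suc (M + K) choose Suc K) *
      ((x + y + real M * a + a) * real (Suc K) * (A * ((y + real M * a) / y)))"
    by (simp add: mult_left_mono)
  also have "\<dots> = (x + y + real M * a + a) / y * real (Suc K) * nbinom_weight a x y (Suc M) (Suc K)"
    using factorial_power_Suc[of y M "-a"] by (simp add: nbinom_weight_def A_def mult_ac)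
  finally show ?thesis .
qed

text \<open>A nonzero limit would be positive, so that eventually \<open>g k\<close> would exceed
  \<open>l / (2 * C)\<close> divided by \<open>Suc k\<close>, against the divergence of the harmonic
  series.\<close>

lemma LIMSEQ_zero_if_summable_bound:
  fixes f g :: "nat \<Rightarrow> real"
  assumes lim: "f \<longlonglongrightarrow> l" and nonneg: "\<And>k. f k \<ge> 0" and "C > 0"
    and g: "summable g" and le: "\<And>k. f k \<le> C * real (Suc k) * g k"
  shows "l = 0"
proof (rule ccontr)
  assume "l \<noteq> 0"
  moreover have "l \<ge> 0"
    using lim nonneg by (intro LIMSEQ_le_const) auto
  ultimately have "l > 0" by simp
  then have "\<forall>\<^sub>F k in sequentially. l / 2 < f k"
    using lim by (intro order_tendstoD) auto
  then have "\<forall>\<^sub>F k in sequentially. norm (l / (2 * C) * inverse (real (Suc k))) \<le> g k"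
  proof eventually_elim
    case (elim k)
    have "l / 2 \<le> g k * (C * real (Suc k))"
      using elim le[of k] by (simp add: mult.commute)
    then have "l / 2 / (C * real (Suc k)) \<le> g k"
      using \<open>C > 0\<close> by (subst pos_divide_le_eq) simp_all
    moreover have "norm (l / (2 * C) * inverse (real (Suc k))) = l / 2 / (C * real (Suc k))"
      using \<open>l > 0\<close> \<open>C > 0\<close> by (simp add: abs_mult field_simps)
    ultimately show ?case by linarith
  qed
  then have "summable (\<lambda>k. l / (2 * C) * inverse (real (Suc k)))"
    using g by (rule summable_comparison_test_ev)
  then have "summable (\<lambda>k. inverse (real (Suc k)))"
    using \<open>l > 0\<close> \<open>C > 0\<close> summable_mult_D[of "l / (2 * C)" "\<lambda>k. inverse (real (Suc k))"] by simp
  then have "summable (\<lambda>k. inverse (real k))"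
    by (subst (asm) summable_Suc_iff)
  then show False using not_summable_harmonic[where 'a=real] by simp
qed

lemma nbinom_weight_sums:
  assumes "a \<ge> 0" "x \<ge> 0" "y > 0"
  shows "nbinom_weight a x y M sums 1"
proof (induction M)
  case 0
  have eq: "nbinom_weight a x y 0 = (\<lambda>k. if k = 0 then 1 else 0)"
    by (auto simp: nbinom_weight_def)
  show ?case unfolding eq using sums_single[of 0 "\<lambda>_. 1::real"] by simp
next
  case (Suc M)
  let ?P = "\<lambda>M K. \<Sum>k<Suc K. nbinom_weight a x y M k"
  have diff: "?P (Suc M) K = ?P M K - nbinom_gap a x y M K" for K
    using sum_nbinom_weight_diff[OF assms, where M = M and K = K] by simp
  \<comment> \<open>Summability comes before the value: as the gap is nonnegative, the partial sums
    for \<open>Suc M\<close> stay below those for \<open>M\<close>, hence below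
    \<open>1\<close>.\<close>
  have "summable (nbinom_weight a x y (Suc M))"
  proof (rule summableI_nonneg_bounded)
    fix K
    have "(\<Sum>k<K. nbinom_weight a x y (Suc M) k) \<le> ?P (Suc M) K"
      using nbinom_weight_nonneg[OF assms] by simp
    also have "\<dots> \<le> ?P M K" using diff nbinom_gap_nonneg[OF assms] by simp
    also have "\<dots> \<le> 1"
      using sum_le_suminf[OF sums_summable[OF Suc.IH], of "{..<Suc K}"] sums_unique[OF Suc.IH]
        nbinom_weight_nonneg[OF assms] by simp
    finally show "(\<Sum>k<K. nbinom_weight a x y (Suc M) k) \<le> 1" .
  qed (rule nbinom_weight_nonneg[OF assms])
  then obtain s where s: "nbinom_weight a x y (Suc M) sums s" by blast
  have "?P (Suc M) \<longlonglongrightarrow> s" "?P M \<longlonglongrightarrow> 1"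
    using LIMSEQ_Suc[OF s[unfolded sums_def]] LIMSEQ_Suc[OF Suc.IH[unfolded sums_def]] by auto
  then have "(\<lambda>K. ?P M K - ?P (Suc M) K) \<longlonglongrightarrow> 1 - s"
    by (intro tendsto_diff)
  \<comment> \<open>The mass \<open>1 - s\<close> missing at \<open>Suc M\<close> is the limit of
    the gap, and so must be shown to vanish.\<close>
  then have lim: "nbinom_gap a x y M \<longlonglongrightarrow> 1 - s"
    by (simp add: sum_nbinom_weight_diff[OF assms] del: sum.lessThan_Suc)
  have "1 - s = 0"
  proof (rule LIMSEQ_zero_if_summable_bound[OF lim])
    show "(x + y + real M * a + a) / y > 0"
      using assms by (intro divide_pos_pos add_pos_nonneg add_nonneg_pos) auto
    show "summable (\<lambda>K. nbinom_weight a x y (Suc M) (Suc K))"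
      using s by (subst summable_Suc_iff) (rule sums_summable)
  qed (use nbinom_gap_nonneg[OF assms] nbinom_gap_le[OF assms] in auto)
  then show ?case using s by simp
qed

section \<open>Factorial moments of the negative Polya distribution\<close>

text \<open>Both sides equal \<open>fact (M + j + r - 1) / (fact j * fact (M - 1))\<close>.\<close>

lemma binomial_rising_factorial_power:
  assumes "M > 0"
  shows "real ((M + (j + r) - 1) choose (j + r)) * factorial_power (real (j + r)) r 1
       = rising 1 (real M) r * real ((M + r + j - 1) choose j)"
proof -
  obtain M' where M: "M = Suc M'" using assms by (cases M) auto
  have "real ((M' + (j + r)) choose (j + r)) = fact (M' + (j + r)) / (fact (j + r) * fact M')"
    by (subst binomial_fact) auto
  moreover have "real ((M' + r + j) choose j) = fact (M' + r + j) / (fact j * fact (M' + r))"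
    by (subst binomial_fact) auto
  moreover have "factorial_power (real (j + r)) r 1 = fact (j + r) / fact j"
    using factorial_power_nat_fact[of j r] by (simp add: field_simps)
  moreover have "rising 1 (real M) r = fact (M' + r) / fact M'"
    using rising_nat_fact[of M' r] M by (simp add: field_simps)
  ultimately show ?thesis
    unfolding M by (simp add: ac_simps)
qed

text \<open>Moving \<open>r * a\<close> from \<open>y\<close> to \<open>x\<close> and
  \<open>r\<close> from the index to \<open>M\<close> preserves both \<open>x + y\<close> and the
  length of the denominator product, so only the numerator products split. The bound on
  \<open>r * a\<close> keeps the new \<open>y\<close> positive.\<close>

lemma nbinom_weight_shift:
  assumes "a \<ge> 0" "x \<ge> 0" "real r * a < y" "M > 0"
  shows "nbinom_weight a x y M (j + r) * factorial_power (real (j + r)) r 1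
       = rising 1 (real M) r * rising a x r / factorial_power (y - a) r a
         * nbinom_weight a (x + real r * a) (y - real r * a) (M + r) j"
proof -
  have "rising a (y - real r * a) r > 0" using assms by (intro rising_pos) auto
  then have pos: "factorial_power (y - a) r a > 0" by (simp add: factorial_power_reverse)
  have x: "rising a x (j + r) = rising a x r * rising a (x + real r * a) j"
    using factorial_power_add[of x r j "-a"] by (simp add: add.commute)
  have y: "rising a (y - real r * a) (M + r) = factorial_power (y - a) r a * rising a y M"
    using factorial_power_add[of "y - real r * a" r M "-a"]
    by (simp add: add.commute factorial_power_reverse)
  show ?thesis
    using binomial_rising_factorial_power[OF \<open>M > 0\<close>, of j r] pos
    unfolding nbinom_weight_def x y
    by (simp add: divide_simps ac_simps)
qed

text \<open>The terms with \<open>k < r\<close> vanish; by the shift the others are a constant times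
  weights of total mass one.\<close>

lemma nbinom_factorial_moment:
  assumes "a \<ge> 0" "x \<ge> 0" "real r * a < y" "M > 0"
  shows "(\<lambda>k. nbinom_weight a x y M k * factorial_power (real k) r 1) sums
           (rising 1 (real M) r * rising a x r / factorial_power (y - a) r a)"
proof -
  let ?f = "\<lambda>k. nbinom_weight a x y M k * factorial_power (real k) r 1"
  let ?C = "rising 1 (real M) r * rising a x r / factorial_power (y - a) r a"
  have "(\<lambda>j. ?f (j + r)) sums (?C * 1)"
    unfolding nbinom_weight_shift[OF assms]
    using assms by (intro sums_mult nbinom_weight_sums) auto
  moreover have "(\<Sum>k<r. ?f k) = 0"
    by (rule sum.neutral) (simp add: factorial_power_nat_eq_0)
  ultimately show ?thesis using sums_iff_shift[of ?f r ?C] by simp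
qed

section \<open>The Polya distribution: total mass and factorial moments\<close>

text \<open>The new factor \<open>x + y + M * a\<close> splits as
  \<open>(x + k * a) + (y + (M - k) * a)\<close>; each part lengthens one of the two products, and
  Pascal's rule recombines the sums.\<close>

lemma rising_vandermonde:
  "(\<Sum>k\<le>M. real (M choose k) * rising a x k * rising a y (M - k)) = rising a (x + y) M"
proof (induction M)
  case (Suc M)
  let ?t = "\<lambda>i j. rising a x i * rising a y j"
  have "rising a (x + y) (Suc M)
      = (\<Sum>k\<le>M. real (M choose k) * ?t k (M - k) * ((x + real k * a) + (y + real (M - k) * a)))"
    unfolding factorial_power_Suc Suc.IH[symmetric] sum_distrib_right
    by (intro sum.cong) (auto simp: of_nat_diff algebra_simps)
  also have "\<dots> = (\<Sum>k\<le>M. real (M choose k) * ?t (Suc k) (M - k))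
                + (\<Sum>k\<le>M. real (M choose k) * ?t k (Suc M - k))"
    unfolding sum.distrib[symmetric]
    by (intro sum.cong) (auto simp: Suc_diff_le factorial_power_Suc algebra_simps)
  \<comment> \<open>The added term at \<open>k = Suc M\<close> is zero, because
    \<open>M choose Suc M\<close> is; it aligns the ranges for the index shift.\<close>
  also have "(\<Sum>k\<le>M. real (M choose k) * ?t k (Suc M - k))
      = (\<Sum>k\<le>Suc M. real (M choose k) * ?t k (Suc M - k))"
    by simp
  also have "\<dots> = ?t 0 (Suc M) + (\<Sum>k\<le>M. real (M choose Suc k) * ?t (Suc k) (M - k))"
    by (subst sum.atMost_Suc_shift) simp
  also have "(\<Sum>k\<le>M. real (M choose k) * ?t (Suc k) (M - k))
      + (?t 0 (Suc M) + (\<Sum>k\<le>M. real (M choose Suc k) * ?t (Suc k) (M - k)))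
      = (\<Sum>k\<le>Suc M. real (Suc M choose k) * ?t k (Suc M - k))"
    unfolding sum.atMost_Suc_shift[of _ M] by (simp add: sum.distrib algebra_simps)
  finally show ?case by (simp add: mult.assoc)
qed simp

text \<open>For \<open>a = 0\<close> this is the binomial distribution with success probability
  \<open>x / (x + y)\<close>. The binomial coefficient makes it vanish for \<open>k > M\<close>, so
  it can be handled as an infinite series.\<close>

definition polya_weight :: "real \<Rightarrow> real \<Rightarrow> real \<Rightarrow> nat \<Rightarrow> nat \<Rightarrow> real" where
  "polya_weight a x y M k =
     real (M choose k) * rising a x k * rising a y (M - k) / rising a (x + y) M"

lemma polya_weight_sums:
  assumes "a \<ge> 0" "x + y > 0"
  shows "polya_weight a x y M sums 1"
proof -
  have "polya_weight a x y M sums (\<Sum>k\<le>M. polya_weight a x y M k)"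
    by (rule sums_finite) (auto simp: polya_weight_def)
  also have "(\<Sum>k\<le>M. polya_weight a x y M k) = 1"
    using rising_pos[OF assms(2,1), of M]
    by (simp add: polya_weight_def rising_vandermonde flip: sum_divide_distrib)
  finally show ?thesis .
qed

text \<open>Here \<open>y\<close> stays fixed while \<open>x\<close> grows by \<open>r * a\<close>
  and \<open>M\<close> drops by \<open>r\<close>, so the denominator also splits and contributes
  \<open>rising a (x + y) r\<close>.\<close>

lemma polya_weight_shift:
  assumes "a \<ge> 0" "x + y > 0"
  shows "polya_weight a x y M (j + r) * factorial_power (real (j + r)) r 1
       = factorial_power (real M) r 1 * rising a x r / rising a (x + y) r
         * polya_weight a (x + real r * a) y (M - r) j"
proof (cases "j + r \<le> M")
  case True
  then obtain i where M: "M = i + j + r" by (metis add.assoc le_iff_add add.commute)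
  have "real ((i + j + r) choose (j + r)) = fact (i + j + r) / (fact (j + r) * fact i)"
    by (subst binomial_fact) auto
  moreover have "real ((i + j) choose j) = fact (i + j) / (fact j * fact i)"
    by (subst binomial_fact) auto
  moreover have "factorial_power (real (j + r)) r 1 = fact (j + r) / fact j"
    "factorial_power (real (i + j + r)) r 1 = fact (i + j + r) / fact (i + j)"
    using factorial_power_nat_fact[of j r] factorial_power_nat_fact[of "i + j" r]
    by (simp_all add: field_simps)
  ultimately have choose:
    "real ((i + j + r) choose (j + r)) * factorial_power (real (j + r)) r 1
     = factorial_power (real (i + j + r)) r 1 * real ((i + j) choose j)"
    by simp
  have x: "rising a x (j + r) = rising a x r * rising a (x + real r * a) j"
    using factorial_power_add[of x r j "-a"] by (simp add: add.commute)
  have xy: "rising a (x + y) (i + j + r) = rising a (x + y) r * rising a (x + y + real r * a) (i + j)"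
    using factorial_power_add[of "x + y" r "i + j" "-a"] by (simp add: add.commute)
  show ?thesis
    using choose unfolding polya_weight_def M x xy by (simp add: ac_simps)
next
  case False
  \<comment> \<open>Both sides are zero. For \<open>r > M\<close> the truncated \<open>M - r\<close>
    says nothing about the right-hand weight; there the falling power of \<open>M\<close> vanishes
    instead.\<close>
  then have "M < j + r" "r \<le> M \<Longrightarrow> M - r < j"
    by auto
  then show ?thesis
    by (cases "r \<le> M") (simp_all add: polya_weight_def factorial_power_nat_eq_0 binomial_eq_0)
qed

lemma polya_factorial_moment:
  assumes "a \<ge> 0" "x \<ge> 0" "x + y > 0"
  shows "(\<lambda>k. polya_weight a x y M k * factorial_power (real k) r 1) sums
           (factorial_power (real M) r 1 * rising a x r / rising a (x + y) r)"
proof -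
  let ?f = "\<lambda>k. polya_weight a x y M k * factorial_power (real k) r 1"
  let ?C = "factorial_power (real M) r 1 * rising a x r / rising a (x + y) r"
  have "x + real r * a + y > 0"
    using add_pos_nonneg[of "x + y" "real r * a"] assms by (simp add: algebra_simps)
  then have "(\<lambda>j. ?f (j + r)) sums (?C * 1)"
    unfolding polya_weight_shift[OF assms(1,3)]
    using assms by (intro sums_mult polya_weight_sums)
  moreover have "(\<Sum>k<r. ?f k) = 0"
    by (rule sum.neutral) (simp add: factorial_power_nat_eq_0)
  ultimately show ?thesis using sums_iff_shift[of ?f r ?C] by simp
qed

section \<open>The weights of the operator as urn distributions\<close>

lemma w_minus_one:
  assumes "n > 0"
  shows "w (-1) p a n k x = polya_weight a x (1 - x) (n + p) k"
proof (cases "k \<le> n + p")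
  case True
  then have "nat (int n + int p - int k) = n + p - k" "nat (int n + int p) = n + p" by linarith+
  then show ?thesis using assms by (simp add: w_def polya_weight_def)
next
  case False
  moreover have "nat (int n + int p) = n + p" by linarith
  ultimately show ?thesis by (simp add: w_def polya_weight_def)
qed

text \<open>The prefactor \<open>M / (M + k)\<close> with \<open>M = n + p\<close> turns
  \<open>M + k choose k\<close> into \<open>M + k - 1 choose k\<close>, by absorption.\<close>

lemma w_zero:
  assumes "n > 0"
  shows "w 0 p a n k x = nbinom_weight a x 1 (n + p) k"
proof -
  obtain m where m: "n + p = Suc m" using assms by (cases "n + p") auto
  have "(Suc m + k) * (m + k choose k) = Suc m * (Suc m + k choose k)"
    using binomial_absorb_comp[of "Suc m + k" k] by simp
  then have "real (Suc m + k) * real (m + k choose k) = real (Suc m) * real (Suc m + k choose k)"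
    by (simp only: flip: of_nat_mult)
  then have choose: "real (Suc m) / (real (Suc m) + (real_of_int 0 + 1) * real k)
      * real (Suc m + k choose k) = real (Suc m + k - 1 choose k)"
    by (simp add: field_simps)
  have nat: "nat (int (Suc m) + (0 + 1) * int k) = Suc m + k" "nat (int (Suc m) + 0 * int k) = Suc m"
    by simp_all
  show ?thesis
    unfolding w_def nbinom_weight_def m nat choose by (simp add: add.commute)
qed

text \<open>Since the weights for \<lambda> = -1 vanish beyond \<open>n + p\<close>, a single
  \<open>sums\<close> fact yields value and convergence for both \<lambda>.\<close>

lemma L_if_sums:
  assumes "l \<in> {-1, 0}" "n > 0" "(\<lambda>k. w l p a n k x * f (real k / real n)) sums s"
  shows "L_converges l p a n f x \<and> L l p a n f x = s"
proof (cases "l = -1")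
  case True
  have "(\<lambda>k. w l p a n k x * f (real k / real n)) sums
          (\<Sum>k\<le>n + p. w l p a n k x * f (real k / real n))"
    by (rule sums_finite) (auto simp: True w_minus_one[OF assms(2)] polya_weight_def)
  then show ?thesis
    using True assms(3) sums_unique2 by (simp add: L_converges_def L_def)
next
  case False
  then show ?thesis
    using assms by (auto simp: L_converges_def L_def sums_iff)
qed

text \<open>The rising power of \<open>0\<close> kills every term with \<open>k > 0\<close>, and
  \<open>f 0 = 0\<close> kills the remaining one. Hence the moments at \<open>x = 0\<close> require
  no bound on \<open>a\<close>.\<close>

lemma L_at_0:
  assumes "l \<in> {-1, 0}" "n > 0" "f 0 = 0"
  shows "L_converges l p a n f 0 \<and> L l p a n f 0 = 0"
proof (rule L_if_sums)
  have "w l p a n k 0 * f (real k / real n) = 0" for k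
    using \<open>f 0 = 0\<close> by (cases k) (auto simp: w_def factorial_power_Suc_left)
  then show "(\<lambda>k. w l p a n k 0 * f (real k / real n)) sums 0"
    by (simp only: sums_zero)
qed fact+

section \<open>Factorial and power moments for both values of \<lambda>\<close>

text \<open>The sign \<open>2 * c + 1\<close> merges two formulas: for \<open>c = 0\<close> it gives
  a rising power of \<open>m\<close> over a falling one from \<open>1 - a\<close>; for
  \<open>c = -1\<close> a falling power of \<open>m\<close> over
  \<open>rising a 1 r\<close>.\<close>

definition factorial_moment :: "real \<Rightarrow> real \<Rightarrow> real \<Rightarrow> real \<Rightarrow> nat \<Rightarrow> real" where
  "factorial_moment c a m x r =
     rising (2 * c + 1) m r * rising a x r / factorial_power (1 - (c + 1) * a) r ((2 * c + 1) * a)"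

lemma w_factorial_moment:
  fixes l :: int
  defines "c \<equiv> real_of_int l"
  assumes "l \<in> {-1, 0}" "n > 0" "a \<ge> 0" "x \<in> I_interval l" "real r * (c + 1) * a < 1"
  shows "(\<lambda>k. w l p a n k x * factorial_power (real k) r 1) sums
           factorial_moment c a (real (n + p)) x r"
proof (cases "l = 0")
  case True
  then show ?thesis
    using assms nbinom_factorial_moment[of a x r 1 "n + p"]
    by (simp add: w_zero I_interval_def factorial_moment_def)
next
  case False
  then have "l = -1" using assms by simp
  then show ?thesis
    using assms polya_factorial_moment[of a x "1 - x" "n + p" r]
    by (simp add: w_minus_one I_interval_def factorial_moment_def)
qed

text \<open>The coefficients are the Stirling numbers of the second kind.\<close>

lemma power_eq_factorial_powers:
  "y ^ 2 = factorial_power y 2 1 + factorial_power y 1 1"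
  "y ^ 3 = factorial_power y 3 1 + 3 * factorial_power y 2 1 + factorial_power y 1 1"
  "y ^ 4 = factorial_power y 4 1 + 6 * factorial_power y 3 1 + 7 * factorial_power y 2 1
         + factorial_power y 1 1"
  by (simp_all add: eval_nat_numeral factorial_power_Suc) algebra+

lemma L_moments:
  fixes l :: int and p n :: nat and a x :: real
  assumes l: "l \<in> {-1, 0}" and n: "n > 0" and a: "a \<ge> 0" and x: "x \<in> I_interval l"
  defines "c \<equiv> real_of_int l" and "N \<equiv> real n"
  defines "\<mu> \<equiv> factorial_moment c a (real (n + p)) x"
  shows "L_converges l p a n (\<lambda>t. 1) x \<and> L l p a n (\<lambda>t. 1) x = 1"
    and "(c + 1) * a < 1 \<Longrightarrow>
      L_converges l p a n (\<lambda>t. t) x \<and> L l p a n (\<lambda>t. t) x = \<mu> 1 / N"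
    and "2 * (c + 1) * a < 1 \<Longrightarrow>
      L_converges l p a n (\<lambda>t. t ^ 2) x \<and> L l p a n (\<lambda>t. t ^ 2) x = (\<mu> 2 + \<mu> 1) / N ^ 2"
    and "3 * (c + 1) * a < 1 \<Longrightarrow>
      L_converges l p a n (\<lambda>t. t ^ 3) x \<and>
      L l p a n (\<lambda>t. t ^ 3) x = (\<mu> 3 + 3 * \<mu> 2 + \<mu> 1) / N ^ 3"
    and "4 * (c + 1) * a < 1 \<Longrightarrow>
      L_converges l p a n (\<lambda>t. t ^ 4) x \<and>
      L l p a n (\<lambda>t. t ^ 4) x = (\<mu> 4 + 6 * \<mu> 3 + 7 * \<mu> 2 + \<mu> 1) / N ^ 4"
proof -
  have ca: "(c + 1) * a \<ge> 0" using l a by (auto simp: c_def)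
  \<comment> \<open>As \<open>(c + 1) * a\<close> is nonnegative, the bound for the top order
    \<open>s\<close> covers all lower factorial moments in the expansion.\<close>
  have mu: "(\<lambda>k. w l p a n k x * factorial_power (real k) r 1) sums \<mu> r"
    if "real s * (c + 1) * a < 1" "r \<le> s" for r s
  proof -
    have "real r * ((c + 1) * a) \<le> real s * ((c + 1) * a)"
      using that(2) ca by (intro mult_right_mono) auto
    then show ?thesis
      using w_factorial_moment[OF l n a x, of r] that(1) by (simp add: \<mu>_def c_def)
  qed
  show "L_converges l p a n (\<lambda>t. 1) x \<and> L l p a n (\<lambda>t. 1) x = 1"
    using mu[of 0 0] by (intro L_if_sums l n) (simp add: \<mu>_def factorial_moment_def)
  show "L_converges l p a n (\<lambda>t. t) x \<and> L l p a n (\<lambda>t. t) x = \<mu> 1 / N" if "(c + 1) * a < 1"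
    using sums_divide[OF mu[of 1 1], of N] that
    by (intro L_if_sums l n) (simp add: N_def factorial_power_Suc)
  show "L_converges l p a n (\<lambda>t. t ^ 2) x \<and> L l p a n (\<lambda>t. t ^ 2) x = (\<mu> 2 + \<mu> 1) / N ^ 2"
    if "2 * (c + 1) * a < 1"
  proof (rule L_if_sums[OF l n])
    show "(\<lambda>k. w l p a n k x * (real k / real n) ^ 2) sums ((\<mu> 2 + \<mu> 1) / N ^ 2)"
      using sums_divide[OF sums_add[OF mu[of 2 2] mu[of 2 1]], of "N ^ 2"] that
      by (simp add: N_def power_divide power_eq_factorial_powers(1)[of "real _"] algebra_simps)
  qed
  show "L_converges l p a n (\<lambda>t. t ^ 3) x \<and>
      L l p a n (\<lambda>t. t ^ 3) x = (\<mu> 3 + 3 * \<mu> 2 + \<mu> 1) / N ^ 3"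
    if "3 * (c + 1) * a < 1"
  proof (rule L_if_sums[OF l n])
    show "(\<lambda>k. w l p a n k x * (real k / real n) ^ 3) sums ((\<mu> 3 + 3 * \<mu> 2 + \<mu> 1) / N ^ 3)"
      using sums_divide[OF sums_add[OF sums_add[OF mu[of 3 3] sums_mult[OF mu[of 3 2]]] mu[of 3 1]],
          of 3 "N ^ 3"] that
      by (simp add: N_def power_divide power_eq_factorial_powers(2)[of "real _"] algebra_simps)
  qed
  show "L_converges l p a n (\<lambda>t. t ^ 4) x \<and>
      L l p a n (\<lambda>t. t ^ 4) x = (\<mu> 4 + 6 * \<mu> 3 + 7 * \<mu> 2 + \<mu> 1) / N ^ 4"
    if "4 * (c + 1) * a < 1"
  proof (rule L_if_sums[OF l n])
    show "(\<lambda>k. w l p a n k x * (real k / real n) ^ 4) sums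
            ((\<mu> 4 + 6 * \<mu> 3 + 7 * \<mu> 2 + \<mu> 1) / N ^ 4)"
      using sums_divide[OF sums_add[OF sums_add[OF sums_add[OF mu[of 4 4] sums_mult[OF mu[of 4 3]]]
              sums_mult[OF mu[of 4 2]]] mu[of 4 1]], of 6 7 "N ^ 4"] that
      by (simp add: N_def power_divide power_eq_factorial_powers(3)[of "real _"] algebra_simps)
  qed
qed

section \<open>Closed forms of the moments\<close>

text \<open>For \<lambda> = 0 and \<open>x > 0\<close> the series for \<open>t ^ r\<close> converges
  only if \<open>r * a < 1\<close>, hence the condition on each moment. The last conjunct shows that
  all these conditions hold for large \<open>n\<close>.\<close>

theorem lemma3p2:
  fixes l :: int and p :: nat and \<alpha> :: "nat \<Rightarrow> real"
  assumes lam: "l \<in> {-1, 0}"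
    and alpha_nonneg: "\<And>n. n \<ge> 1 \<Longrightarrow> \<alpha> n \<ge> 0"
    and alpha_lim: "\<alpha> \<longlonglongrightarrow> 0"
  shows
    "(\<forall>n\<ge>1. \<forall>x\<in>I_interval l.
        (let a = \<alpha> n; N = real n; m = real (n + p); c = real_of_int l in
          (L_converges l p a n (\<lambda>t. 1) x \<and> L l p a n (\<lambda>t. 1) x = 1)
        \<and> (x = 0 \<or> (c + 1) * a < 1 \<longrightarrow>
             L_converges l p a n (\<lambda>t. t) x \<and>
             L l p a n (\<lambda>t. t) x = m / N * (x / (1 - (c + 1) * a)))
        \<and> (x = 0 \<or> 2 * (c + 1) * a < 1 \<longrightarrow>
             L_converges l p a n (\<lambda>t. t ^ 2) x \<and>
             L l p a n (\<lambda>t. t ^ 2) x =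
               m / N ^ 2 * (1 / ((1 - c * a) * (1 - (c + 1) * a))) *
               ((m + c + 1) * x * (x + a) / (1 - 2 * (c + 1) * a) + x * (1 + c * x)))
        \<and> (x = 0 \<or> 3 * (c + 1) * a < 1 \<longrightarrow>
             L_converges l p a n (\<lambda>t. t ^ 3) x \<and>
             L l p a n (\<lambda>t. t ^ 3) x =
               m * x / (N ^ 3 * (1 - (c + 1) * a)) *
               ((m + 2 * c + 1) * (m + 2 * (2 * c + 1)) * (x + a) * (x + 2 * a)
                  / ((1 - (3 * c + 2) * a) * (1 - (5 * c + 3) * a))
                + 3 * (m + 2 * c + 1) * (x + a) / (1 - (3 * c + 2) * a)
                + 1))
        \<and> (x = 0 \<or> 4 * (c + 1) * a < 1 \<longrightarrow>
             L_converges l p a n (\<lambda>t. t ^ 4) x \<and>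
             L l p a n (\<lambda>t. t ^ 4) x =
               m * x / (N ^ 4 * (1 - (c + 1) * a)) *
               ((m + 2 * c + 1) * (m + 2 * (2 * c + 1)) * (m + 3 * (2 * c + 1))
                  * (x + a) * (x + 2 * a) * (x + 3 * a)
                  / ((1 - (3 * c + 2) * a) * (1 - (5 * c + 3) * a) * (1 - (7 * c + 4) * a))
                + 6 * (m + 2 * c + 1) * (m + 2 * (2 * c + 1)) * (x + a) * (x + 2 * a)
                  / ((1 - (3 * c + 2) * a) * (1 - (5 * c + 3) * a))
                + 7 * (m + 2 * c + 1) * (x + a) / (1 - (3 * c + 2) * a)
                + 1))))
     \<and> (\<forall>\<^sub>F n in sequentially. 4 * (real_of_int l + 1) * \<alpha> n < 1)"
proof (intro conjI allI ballI impI, goal_cases)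
  case (1 n x)
  then have n: "n \<ge> 1" and x: "x \<in> I_interval l" by simp_all
  define c where "c = real_of_int l"
  have c: "c = -1 \<or> c = 0" using lam by (auto simp: c_def)
  define a where "a = \<alpha> n"
  define N where "N = real n"
  define m where "m = real (n + p)"
  have a: "a \<ge> 0" using alpha_nonneg n by (simp add: a_def)
  have n': "n > 0" and N: "N > 0" using n by (auto simp: N_def)
  define \<mu> where "\<mu> = factorial_moment c a m x"
  note mom = L_moments[OF lam n' a x, of p, folded c_def N_def m_def, folded \<mu>_def]
  note zero = L_at_0[OF lam n']
  have fp: "factorial_power y 1 h = y" "factorial_power y 2 h = y * (y - h)"
    "factorial_power y 3 h = y * (y - h) * (y - 2 * h)"
    "factorial_power y 4 h = y * (y - h) * (y - 2 * h) * (y - 3 * h)" for y h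
    by (simp_all add: eval_nat_numeral factorial_power_Suc)
  \<comment> \<open>Successive factors of the denominator, which starts at
    \<open>1 - (c + 1) * a\<close> and falls in steps of \<open>(2 * c + 1) * a\<close>, are put
    into the form used in the claim.\<close>
  have shifts: "x - - a = x + a" "x - 2 * - a = x + 2 * a" "x - 3 * - a = x + 3 * a"
    "m - - (2 * c + 1) = m + 2 * c + 1" "m - 2 * - (2 * c + 1) = m + 2 * (2 * c + 1)"
    "m - 3 * - (2 * c + 1) = m + 3 * (2 * c + 1)"
    "1 - (c + 1) * a - (2 * c + 1) * a = 1 - (3 * c + 2) * a"
    "1 - (c + 1) * a - 2 * ((2 * c + 1) * a) = 1 - (5 * c + 3) * a"
    "1 - (c + 1) * a - 3 * ((2 * c + 1) * a) = 1 - (7 * c + 4) * a"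
    by (simp_all add: algebra_simps)
  have mus: "\<mu> 1 = m * x / (1 - (c + 1) * a)"
    "\<mu> 2 = m * (m + 2 * c + 1) * (x * (x + a)) / ((1 - (c + 1) * a) * (1 - (3 * c + 2) * a))"
    "\<mu> 3 = m * (m + 2 * c + 1) * (m + 2 * (2 * c + 1)) * (x * (x + a) * (x + 2 * a))
       / ((1 - (c + 1) * a) * (1 - (3 * c + 2) * a) * (1 - (5 * c + 3) * a))"
    "\<mu> 4 = m * (m + 2 * c + 1) * (m + 2 * (2 * c + 1)) * (m + 3 * (2 * c + 1))
         * (x * (x + a) * (x + 2 * a) * (x + 3 * a))
       / ((1 - (c + 1) * a) * (1 - (3 * c + 2) * a) * (1 - (5 * c + 3) * a) * (1 - (7 * c + 4) * a))"
    unfolding \<mu>_def factorial_moment_def fp shifts by (rule refl)+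
  show ?case
    unfolding Let_def a_def[symmetric] N_def[symmetric] m_def[symmetric] c_def[symmetric]
  proof (cases "x = 0", goal_cases)
    case 1
    \<comment> \<open>The right-hand sides are \<open>0\<close> here even where a denominator
      vanishes, since division by zero yields \<open>0\<close>.\<close>
    then show ?case using mom(1) zero by simp
  next
    case 2
    \<comment> \<open>The claimed second moment groups its terms differently from
      \<open>\<mu>\<close>, so the two are compared separately for \<open>c = -1\<close> and
      \<open>c = 0\<close>.\<close>
    have mu2: "(\<mu> 2 + \<mu> 1) / N ^ 2 =
        m / N ^ 2 * (1 / ((1 - c * a) * (1 - (c + 1) * a))) *
        ((m + c + 1) * x * (x + a) / (1 - 2 * (c + 1) * a) + x * (1 + c * x))"
      if "2 * (c + 1) * a < 1"
      using c
    proof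
      assume "c = -1"
      then show ?thesis
        unfolding mus using a N by (simp add: divide_simps) (simp add: algebra_simps)
    next
      assume "c = 0"
      then have "1 - a > 0" "1 - 2 * a > 0" using that a by auto
      then show ?thesis
        unfolding mus using \<open>c = 0\<close> N by (simp add: divide_simps) (simp add: algebra_simps)
    qed
    \<comment> \<open>Only distributivity and multiplicativity of the inverse enter, so the
      denominators may be arbitrary, even zero.\<close>
    have factor3: "(m * M1 * M2 * (x * X1 * X2) / (D1 * D2 * D3) + 3 * (m * M1 * (x * X1) / (D1 * D2))
          + m * x / D1) / N'
        = m * x / (N' * D1) * (M1 * M2 * X1 * X2 / (D2 * D3) + 3 * M1 * X1 / D2 + 1)"
      for M1 M2 X1 X2 D1 D2 D3 N' :: real
      by (simp add: add_divide_distrib distrib_left mult_ac)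
    have factor4: "(m * M1 * M2 * M3 * (x * X1 * X2 * X3) / (D1 * D2 * D3 * D4)
          + 6 * (m * M1 * M2 * (x * X1 * X2) / (D1 * D2 * D3)) + 7 * (m * M1 * (x * X1) / (D1 * D2))
          + m * x / D1) / N'
        = m * x / (N' * D1) * (M1 * M2 * M3 * X1 * X2 * X3 / (D2 * D3 * D4)
          + 6 * M1 * M2 * X1 * X2 / (D2 * D3) + 7 * M1 * X1 / D2 + 1)"
      for M1 M2 M3 X1 X2 X3 D1 D2 D3 D4 N' :: real
      by (simp add: add_divide_distrib distrib_left mult_ac)
    have mu3: "(\<mu> 3 + 3 * \<mu> 2 + \<mu> 1) / N ^ 3 =
         m * x / (N ^ 3 * (1 - (c + 1) * a)) *
               ((m + 2 * c + 1) * (m + 2 * (2 * c + 1)) * (x + a) * (x + 2 * a)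
                  / ((1 - (3 * c + 2) * a) * (1 - (5 * c + 3) * a))
                + 3 * (m + 2 * c + 1) * (x + a) / (1 - (3 * c + 2) * a)
                + 1)"
      unfolding mus by (rule factor3)
    have mu4: "(\<mu> 4 + 6 * \<mu> 3 + 7 * \<mu> 2 + \<mu> 1) / N ^ 4 =
         m * x / (N ^ 4 * (1 - (c + 1) * a)) *
               ((m + 2 * c + 1) * (m + 2 * (2 * c + 1)) * (m + 3 * (2 * c + 1))
                  * (x + a) * (x + 2 * a) * (x + 3 * a)
                  / ((1 - (3 * c + 2) * a) * (1 - (5 * c + 3) * a) * (1 - (7 * c + 4) * a))
                + 6 * (m + 2 * c + 1) * (m + 2 * (2 * c + 1)) * (x + a) * (x + 2 * a)
                  / ((1 - (3 * c + 2) * a) * (1 - (5 * c + 3) * a))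
                + 7 * (m + 2 * c + 1) * (x + a) / (1 - (3 * c + 2) * a)
                + 1)"
      unfolding mus by (rule factor4)
    have mu1: "\<mu> 1 / N = m / N * (x / (1 - (c + 1) * a))"
      unfolding mus by simp
    show ?case
      by (intro conjI[OF mom(1)] conjI impI; elim disjE)
        (use 2 in \<open>simp_all only: mom mu1 mu2 mu3 mu4\<close>)
  qed
next
  case 2
  have "(\<lambda>n. 4 * (real_of_int l + 1) * \<alpha> n) \<longlonglongrightarrow> 4 * (real_of_int l + 1) * 0"
    by (intro tendsto_intros alpha_lim)
  then show ?case
    by (intro order_tendstoD) auto
qed

end
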